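(* Let $K\in\{\mathbb{R},\mathbb{C}\}$, let $A$ be a unitary algebra over $K$ with basis $\{e_0=1,e_1,\dots,e_n\}$, and for $m\in\mathbb{Z}$ let $F_m=\sum_{k=0}^{n} f_{m+k}e_k\in A$, where $(f_j)_{j\in\mathbb{Z}}$ is the Fibonacci sequence extended to negative indices. Then for all $m\in\mathbb{N}$, $$F_{m-1}F_{m+1}-F_m^{2}=(-1)^{m}\left(F_{-1}F_{1}-F_0^{2}\right).$$
   Context: The Fibonacci sequence is $f_0=0$, $f_1=1$, $f_j=f_{j-1}+f_{j-2}$ for $j\ge 2$, extended to negative indices by $f_{-j}=(-1)^{j+1}f_j$ (equivalently, so that the recurrence $f_j=f_{j-1}+f_{j-2}$ holds for all $j\in\mathbb{Z}$). Here $\mathbb{N}=\{0,1,2,\dots\}$. The algebra $A$ is arbitrary with unit $e_0=1$: its multiplication is $K$-bilinear and is not assumed to be commutative or associative. The elements $F_m$ are called Fibonacci elements of $A$. *)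

theory Defs
  imports Complex_Main "HOL-Number_Theory.Fib"
begin

definition fib_int :: "int \<Rightarrow> int" where
  "fib_int j =
     (if j \<ge> 0 then int (fib (nat j))
      else (-1) ^ (nat (- j) + 1) * int (fib (nat (- j))))"

lemma fib_int_rec: "fib_int j = fib_int (j - 1) + fib_int (j - 2)"
proof -
  consider "j \<ge> 2" | "j = 1" | "j = 0" | "j < 0" by linarith
  then show ?thesis
  proof cases
    case 1
    define k where "k = nat (j - 2)"
    have "j = int k + 2" using 1 by (simp add: k_def)
    moreover have "nat (int k + 2) = Suc (Suc k)" "nat (1 + int k) = Suc k" by auto
    ultimately show ?thesis by (simp add: fib_int_def)
  next
    case 4
    define k where "k = nat (- j)"
    have "j = - int k" "k > 0" using 4 by (simp_all add: k_def)
    moreover have "nat (1 + int k) = Suc k" "nat (2 + int k) = Suc (Suc k)" by auto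
    ultimately show ?thesis by (simp add: fib_int_def algebra_simps)
  qed (simp_all add: fib_int_def numeral_2_eq_2)
qed

text \<open>
  The multiplication is a parameter rather than the one of a type class, because the
  ring classes of the library impose associativity.
\<close>

locale unital_algebra = vector_space scale
  for scale :: "'k::field \<Rightarrow> 'a::ab_group_add \<Rightarrow> 'a" +
  fixes mult :: "'a \<Rightarrow> 'a \<Rightarrow> 'a" (infixl \<open>\<cdot>\<close> 70)
    and one :: 'a
  assumes linear_mult_right: "Vector_Spaces.linear scale scale (\<lambda>y. x \<cdot> y)"
    and linear_mult_left: "Vector_Spaces.linear scale scale (\<lambda>x. x \<cdot> y)"
    and one_mult: "one \<cdot> x = x"
    and mult_one: "x \<cdot> one = x"

definition unital_basis ::
    "('k::field \<Rightarrow> 'a::ab_group_add \<Rightarrow> 'a) \<Rightarrow> 'a \<Rightarrow> nat \<Rightarrow> (nat \<Rightarrow> 'a) \<Rightarrow> bool" where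
  "unital_basis scale one n e \<longleftrightarrow>
     e 0 = one \<and> inj_on e {..n} \<and>
     \<not> module.dependent scale (e ` {..n}) \<and> module.span scale (e ` {..n}) = UNIV"

definition fib_elem ::
    "('k::field \<Rightarrow> 'a::ab_group_add \<Rightarrow> 'a) \<Rightarrow> nat \<Rightarrow> (nat \<Rightarrow> 'a) \<Rightarrow> int \<Rightarrow> 'a" where
  "fib_elem scale n e m = (\<Sum>k\<le>n. scale (of_int (fib_int (m + int k))) (e k))"

end

theory Submission
  imports Defs
begin

text \<open>
  A linear combination of the \<open>e\<^sub>k\<close> depends linearly on its coefficients, so the Fibonacci
  elements inherit the recurrence
  \<open>F\<^sub>j\<^sub>+\<^sub>1 = F\<^sub>j + F\<^sub>j\<^sub>-\<^sub>1\<close> from the Fibonacci numbers. The quantity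
  \<open>D\<^sub>j = F\<^sub>j\<^sub>-\<^sub>1 \<cdot> F\<^sub>j\<^sub>+\<^sub>1 - F\<^sub>j \<cdot> F\<^sub>j\<close> then only depends on the two consecutive elements
  \<open>a = F\<^sub>j\<^sub>-\<^sub>1\<close> and \<open>b = F\<^sub>j\<close>: it is \<open>a \<cdot> a + a \<cdot> b - b \<cdot> b\<close>. Replacing \<open>(a, b)\<close> by \<open>(b, a + b)\<close>
  negates it (\<open>cassini_step\<close>). Since \<open>D\<^sub>j\<close> multiplies by the element of smaller index on the
  left for every \<open>j\<close>, the order of the factors stays consistent throughout, and induction on
  \<open>m\<close> gives the sign \<open>(-1)\<^sup>m\<close> in a noncommutative algebra as well (\<open>cassini_fib_elem\<close>).
\<close>

lemma fib_elem_rec: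
  assumes "vector_space scale"
  shows "fib_elem scale n e (j + 1) = fib_elem scale n e j + fib_elem scale n e (j - 1)"
proof -
  interpret vector_space scale by (rule assms)
  have "fib_int (j + 1 + int k) = fib_int (j + int k) + fib_int (j - 1 + int k)" for k
    using fib_int_rec[of "j + 1 + int k"] by (simp add: algebra_simps)
  then show ?thesis
    by (simp add: fib_elem_def scale_left_distrib sum.distrib)
qed

text \<open>
  Expanding with \<open>c = a + b\<close> turns the left side into \<open>b \<cdot> b - a \<cdot> a - a \<cdot> b\<close>: the product
  \<open>b \<cdot> a\<close> occurs once in \<open>b \<cdot> d\<close> and once in \<open>c \<cdot> c\<close>, so it cancels and never has to be
  compared with \<open>a \<cdot> b\<close>.
\<close>

lemma cassini_step:
  fixes mult :: "'a::ab_group_add \<Rightarrow> 'a \<Rightarrow> 'a" (infixl \<open>\<cdot>\<close> 70)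
  assumes distrib_left: "\<And>x y z. x \<cdot> (y + z) = x \<cdot> y + x \<cdot> z"
    and distrib_right: "\<And>x y z. (x + y) \<cdot> z = x \<cdot> z + y \<cdot> z"
    and c: "c = b + a" and d: "d = c + b"
  shows "b \<cdot> d - c \<cdot> c = - (a \<cdot> c - b \<cdot> b)"
  by (simp add: c d distrib_left distrib_right algebra_simps)

lemma (in unital_algebra) cassini_fib_elem:
  fixes n :: nat and e :: "nat \<Rightarrow> 'a"
  defines "F \<equiv> fib_elem scale n e"
  shows "F (int m - 1) \<cdot> F (int m + 1) - F (int m) \<cdot> F (int m) =
    scale ((-1) ^ m) (F (-1) \<cdot> F 1 - F 0 \<cdot> F 0)"
proof (induction m)
  case 0
  show ?case by simp
next
  case (Suc m)
  have rec: "F (j + 1) = F j + F (j - 1)" for j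
    unfolding F_def by (rule fib_elem_rec) (rule vector_space_axioms)
  have left: "x \<cdot> (y + z) = x \<cdot> y + x \<cdot> z" for x y z
    by (rule module_hom.add[OF Vector_Spaces.linear.axioms(3)[OF linear_mult_right]])
  have right: "(x + y) \<cdot> z = x \<cdot> z + y \<cdot> z" for x y z
    by (rule module_hom.add[OF Vector_Spaces.linear.axioms(3)[OF linear_mult_left]])
  have "F (int m + 2) = F (int m + 1) + F (int m)"
    using rec[of "int m + 1"] by (simp add: add.commute)
  then have "F (int m) \<cdot> F (int m + 2) - F (int m + 1) \<cdot> F (int m + 1) =
      - (F (int m - 1) \<cdot> F (int m + 1) - F (int m) \<cdot> F (int m))"
    using left right rec[of "int m"] by (intro cassini_step)
  also have "\<dots> = scale ((-1) ^ Suc m) (F (-1) \<cdot> F 1 - F 0 \<cdot> F 0)"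
    by (simp only: Suc.IH power_Suc mult_minus1 scale_minus_left)
  finally show ?case by (simp add: add.commute)
qed

theorem theorem2p8:
  fixes scale_real :: "real \<Rightarrow> 'a::ab_group_add \<Rightarrow> 'a"
    and scale_complex :: "complex \<Rightarrow> 'a \<Rightarrow> 'a"
    and mult :: "'a \<Rightarrow> 'a \<Rightarrow> 'a" (infixl \<open>\<cdot>\<close> 70)
    and one :: 'a
    and n :: nat
    and e :: "nat \<Rightarrow> 'a"
  shows "(unital_algebra scale_real mult one \<and> unital_basis scale_real one n e \<longrightarrow>
           (let F = fib_elem scale_real n e in
             \<forall>m::nat. F (int m - 1) \<cdot> F (int m + 1) - F (int m) \<cdot> F (int m) =
               scale_real ((-1) ^ m) (F (-1) \<cdot> F 1 - F 0 \<cdot> F 0))) \<and>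
         (unital_algebra scale_complex mult one \<and> unital_basis scale_complex one n e \<longrightarrow>
           (let F = fib_elem scale_complex n e in
             \<forall>m::nat. F (int m - 1) \<cdot> F (int m + 1) - F (int m) \<cdot> F (int m) =
               scale_complex ((-1) ^ m) (F (-1) \<cdot> F 1 - F 0 \<cdot> F 0)))"
  unfolding Let_def
  by (intro conjI impI allI; elim conjE; rule unital_algebra.cassini_fib_elem)

end
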